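(* Consider the discounted power-allocation Markov decision process defined in the context, with state $(\xi,h)\in\{0,1,\ldots,\xi_m\}\times\mathcal H$ and optimal decision rule $\mu^\star(\xi,h)$. The optimal policy of power allocation $\mu^\star(\xi,h)$ is non-decreasing in both arguments, that is: 1. for any $\xi\in\{0,\ldots,\xi_m\}$ and all $h^+,h^-\in\mathcal H$ with $h^+>h^-$, $\ \mu^\star(\xi,h^+)\ge \mu^\star(\xi,h^-)$; 2. for any $h\in\mathcal H$ and all $\xi^+,\xi^-\in\{0,\ldots,\xi_m\}$ with $\xi^+>\xi^-$, $\ \mu^\star(\xi^+,h)\ge \mu^\star(\xi^-,h)$.
   Context: All energies and powers are non-negative integers. Data: a battery capacity $\xi_m\in\mathbb Z_{\ge 0}$; a finite set of channel-fade coefficients $\mathcal H=\{e_1<e_2<\cdots<e_N\}$ of non-negative numbers; a probability distribution $P_H$ on $\mathcal H$; a probability distribution (of a random variable $X$) on $\{0,1,\ldots,a\}$ for some $a\in\mathbb Z_{\ge 0}$; a constant $N_0W>0$; and a discount factor $\lambda\in(0,1)$. State space: $S=\{0,1,\ldots,\xi_m\}\times\mathcal H$; a state $(\xi,h)$ is the current battery energy and the current channel coefficient. In state $(\xi,h)$ the admissible actions (powers) are $P\in\{0,1,\ldots,\xi\}$. The one-stage reward is $$r((\xi,h),P)=\log\Big(1+\frac{hP}{N_0W}\Big).$$ If action $P$ is taken in state $(\xi,h)$, the next state is $(\min(\xi-P+X,\ \xi_m),\,h_0)$, where $X$ (the recharge energy) has the given distribution on $\{0,\ldots,a\}$, $h_0$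 has distribution $P_H$, $X$ and $h_0$ are independent of each other and of the current state, and both processes are i.i.d. over time slots. The optimal reward function $J^\star:S\to[0,\infty)$ is the optimal (maximal over policies) infinite-horizon expected total $\lambda$-discounted reward as a function of the initial state; it satisfies the Bellman equation $$J^\star(\xi,h)=\max_{P\in\{0,\ldots,\xi\}}\Big\{\log\Big(1+\frac{hP}{N_0W}\Big)+\lambda\,\mathbb E_{h_0,X}\big[J^\star(\min(\xi-P+X,\xi_m),h_0)\big]\Big\}.$$ Only stationary deterministic policies are considered, and the optimal decision rule $\mu^\star:S\to\{0,\ldots,\xi_m\}$ is $$\mu^\star(\xi,h)=\arg\max_{P\in\{0,\ldots,\xi\}}\Big\{\log\Big(1+\frac{hP}{N_0W}\Big)+\lambda\,\mathbb E_{h_0,X}\big[J^\star(\min(\xi-P+X,\xi_m),h_0)\big]\Big\}.$$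
   Formalization: Part 2 is shown for the argmax rule taking the least maximizer in every state or the greatest in every state (automatic if maximizers are unique); for arbitrary tie-breaking it fails, e.g. H={0}, where all powers tie. Part 1 holds for every choice of maximizers. *)

theory Defs
  imports "HOL-Probability.Probability"
begin

text \<open>
  A state is a pair of battery energy and channel coefficient; an action (power) is a natural
  number. A disturbance is a pair (recharge energy, next channel coefficient).
\<close>

type_synonym state = "nat \<times> real"
type_synonym disturbance = "nat \<times> real"

record model =
  capacity :: nat
  fades :: "real set"
  fade_pmf :: "real pmf"
  recharge_pmf :: "nat pmf"
  noise :: real    \<comment> \<open>the product of noise density and bandwidth\<close>
  discount :: real

definition power_allocation_model :: "model \<Rightarrow> bool" where
  "power_allocation_model M \<longleftrightarrow>
     finite (fades M) \<and> (\<forall>h\<in>fades M. 0 \<le> h) \<and> set_pmf (fade_pmf M) \<subseteq> fades M \<and>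
     (\<exists>a. set_pmf (recharge_pmf M) \<subseteq> {0..a}) \<and>
     0 < noise M \<and> 0 < discount M \<and> discount M < 1"

definition states :: "model \<Rightarrow> state set" where
  "states M = {0..capacity M} \<times> fades M"

definition actions :: "state \<Rightarrow> nat set" where
  "actions s = {0..fst s}"

definition reward :: "model \<Rightarrow> state \<Rightarrow> nat \<Rightarrow> real" where
  "reward M s P = ln (1 + snd s * real P / noise M)"

text \<open>Natural-number subtraction is harmless below because admissible powers satisfy \<open>P \<le> fst s\<close>.\<close>

definition next_state :: "model \<Rightarrow> state \<Rightarrow> nat \<Rightarrow> disturbance \<Rightarrow> state" where
  "next_state M s P d = (min (fst s - P + fst d) (capacity M), snd d)"

definition disturbance_pmf :: "model \<Rightarrow> disturbance pmf" where
  "disturbance_pmf M = pair_pmf (recharge_pmf M) (fade_pmf M)"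

text \<open>Stationary deterministic policies. Their values outside the state space are irrelevant.\<close>

definition policies :: "model \<Rightarrow> (state \<Rightarrow> nat) set" where
  "policies M = {\<mu>. \<forall>s\<in>states M. \<mu> s \<in> actions s}"

primrec state_at :: "model \<Rightarrow> (state \<Rightarrow> nat) \<Rightarrow> state \<Rightarrow> disturbance stream \<Rightarrow> nat \<Rightarrow> state" where
  "state_at M \<mu> s \<omega> 0 = s"
| "state_at M \<mu> s \<omega> (Suc n) =
     next_state M (state_at M \<mu> s \<omega> n) (\<mu> (state_at M \<mu> s \<omega> n)) (\<omega> !! n)"

definition total_reward :: "model \<Rightarrow> (state \<Rightarrow> nat) \<Rightarrow> state \<Rightarrow> disturbance stream \<Rightarrow> real" where
  "total_reward M \<mu> s \<omega> =
     (\<Sum>n. discount M ^ n * reward M (state_at M \<mu> s \<omega> n) (\<mu> (state_at M \<mu> s \<omega> n)))"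

text \<open>
  The measure \<^term>\<open>stream_space (measure_pmf (disturbance_pmf M))\<close> is the law of the i.i.d.
  disturbance sequence.
\<close>

definition policy_value :: "model \<Rightarrow> (state \<Rightarrow> nat) \<Rightarrow> state \<Rightarrow> real" where
  "policy_value M \<mu> s =
     (LINT \<omega>|stream_space (measure_pmf (disturbance_pmf M)). total_reward M \<mu> s \<omega>)"

definition optimal_reward :: "model \<Rightarrow> state \<Rightarrow> real" where
  "optimal_reward M s = (SUP \<mu>\<in>policies M. policy_value M \<mu> s)"

definition action_value :: "model \<Rightarrow> state \<Rightarrow> nat \<Rightarrow> real" where
  "action_value M s P =
     reward M s P + discount M *
       measure_pmf.expectation (disturbance_pmf M) (\<lambda>d. optimal_reward M (next_state M s P d))"

definition maximizers :: "model \<Rightarrow> state \<Rightarrow> nat set" where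
  "maximizers M s = {P. is_arg_max (action_value M s) (\<lambda>P. P \<in> actions s) P}"

definition optimal_rule :: "model \<Rightarrow> (state \<Rightarrow> nat) \<Rightarrow> bool" where
  "optimal_rule M \<mu> \<longleftrightarrow> (\<forall>s\<in>states M. \<mu> s \<in> maximizers M s)"

text \<open>
  The maximizer need not be unique: with \<open>fades M = {0}\<close> every action in every state is a maximizer,
  so monotonicity in the battery energy fails for an arbitrary choice of maximizers. A uniform
  tie-breaking convention takes the least maximizer in every state, or the greatest one in every
  state; if maximizers are unique, every optimal rule satisfies it.
\<close>

definition uniform_tie_breaking :: "model \<Rightarrow> (state \<Rightarrow> nat) \<Rightarrow> bool" where
  "uniform_tie_breaking M \<mu> \<longleftrightarrow>
     (\<forall>s\<in>states M. \<mu> s = Min (maximizers M s)) \<or>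
     (\<forall>s\<in>states M. \<mu> s = Max (maximizers M s))"

end

theory Submission
  imports Defs
begin

text \<open>
  Monotonicity in the fade needs only that \<open>ln (1 + h P / n)\<close> has strictly increasing differences
  in \<open>(h, P)\<close>: the continuation value depends on the power but not on the current fade.

  For monotonicity in the energy \<open>k\<close>, the objective is \<open>f P + g (k - P)\<close> with \<open>g\<close> the continuation
  value. If \<open>g\<close> is concave, this has increasing differences in \<open>(k, P)\<close>, so the least and the
  greatest maximizers are monotone. Concavity of the optimal reward comes from value iteration: each
  step is a sup-convolution, which preserves discrete concavity, and the limit of the iterates is the
  optimal reward because both solve the Bellman equation on a finite state space.
\<close>

section \<open>Discrete concavity\<close>

definition increasing_upto :: "nat \<Rightarrow> (nat \<Rightarrow> real) \<Rightarrow> bool" where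
  "increasing_upto c f \<longleftrightarrow> (\<forall>k. Suc k \<le> c \<longrightarrow> f k \<le> f (Suc k))"

text \<open>The local second-difference form, confined to \<open>{0..c}\<close>: each instance is
  one weak linear inequality, so the property survives nonnegative combinations and pointwise
  limits.\<close>

definition concave_upto :: "nat \<Rightarrow> (nat \<Rightarrow> real) \<Rightarrow> bool" where
  "concave_upto c f \<longleftrightarrow> (\<forall>k. Suc (Suc k) \<le> c \<longrightarrow> f k + f (Suc (Suc k)) \<le> 2 * f (Suc k))"

text \<open>Chaining neighbouring second differences shows that the increment at \<open>j\<close> is
  at most the increment at \<open>i\<close>.\<close>

lemma concave_uptoD:
  assumes "concave_upto c f" and "i \<le> j" and "Suc j \<le> c"
  shows "f i + f (Suc j) \<le> f (Suc i) + f j"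
  using assms(2,3)
proof (induction j rule: dec_induct)
  case (step n)
  have "f n + f (Suc (Suc n)) \<le> 2 * f (Suc n)"
    using assms(1) step.prems by (simp add: concave_upto_def)
  with step show ?case by simp
qed simp

text \<open>Adds up \<open>m\<close> comparisons of unit increments; later \<open>m\<close> is the
  difference of two battery energies.\<close>

lemma concave_upto_shift:
  assumes f: "concave_upto c f" and ij: "i \<le> j" and jc: "j + m \<le> c"
  shows "f i + f (j + m) \<le> f (i + m) + f j"
  using jc
proof (induction m)
  case (Suc m)
  have "f (i + m) + f (Suc (j + m)) \<le> f (Suc (i + m)) + f (j + m)"
    by (rule concave_uptoD[OF f]) (use ij Suc.prems in auto)
  with Suc show ?case by simp
qed simp

lemma increasing_upto_recharge:
  assumes "increasing_upto c f"
  shows "increasing_upto c (\<lambda>y. f (min (y + x) c))"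
  unfolding increasing_upto_def
proof (intro allI impI)
  fix k
  show "f (min (k + x) c) \<le> f (min (Suc k + x) c)"
    using assms by (cases "k + x < c") (auto simp: increasing_upto_def min_def not_less)
qed

text \<open>Below the cap the function is a shift of \<open>f\<close>, above it a constant. At the
  kink the increment drops to zero, which respects concavity because \<open>f\<close> is
  increasing.\<close>

lemma concave_upto_recharge:
  assumes inc: "increasing_upto c f" and conc: "concave_upto c f"
  shows "concave_upto c (\<lambda>y. f (min (y + x) c))"
  unfolding concave_upto_def
proof (intro allI impI)
  fix k
  consider "k + x + 2 \<le> c" | "k + x + 1 = c" | "c \<le> k + x" by linarith
  then show "f (min (k + x) c) + f (min (Suc (Suc k) + x) c) \<le> 2 * f (min (Suc k + x) c)"
  proof cases
    case 1
    then show ?thesis using conc by (simp add: concave_upto_def)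
  next
    case 2
    \<comment> \<open>The three values are \<open>f (c - 1)\<close>, \<open>f c\<close>,
      \<open>f c\<close>, so monotonicity of the last step is all that is asked.\<close>
    then have "f (k + x) \<le> f (Suc (k + x))"
      using inc unfolding increasing_upto_def by (metis Suc_eq_plus1 order_refl)
    with 2 show ?thesis by (simp add: min_def)
  qed (simp add: min_def)
qed

text \<open>Max-plus convolution: energy \<open>k\<close> is split into a spent part
  \<open>p\<close> and a stored part \<open>k - p\<close>. At a fixed fade this is the Bellman
  step.\<close>

definition sup_convolution :: "(nat \<Rightarrow> real) \<Rightarrow> (nat \<Rightarrow> real) \<Rightarrow> nat \<Rightarrow> real" where
  "sup_convolution f g k = Max ((\<lambda>p. f p + g (k - p)) ` {0..k})"

lemma sup_convolution_ge: "p \<le> k \<Longrightarrow> f p + g (k - p) \<le> sup_convolution f g k"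
  by (simp add: sup_convolution_def)

lemma sup_convolution_attained:
  obtains p where "p \<le> k" and "sup_convolution f g k = f p + g (k - p)"
proof -
  have "sup_convolution f g k \<in> (\<lambda>p. f p + g (k - p)) ` {0..k}"
    unfolding sup_convolution_def by (rule Max_in) auto
  then show thesis using that by auto
qed

lemma increasing_upto_sup_convolution:
  assumes "increasing_upto c g"
  shows "increasing_upto c (sup_convolution f g)"
  unfolding increasing_upto_def
proof (intro allI impI)
  fix k assume k: "Suc k \<le> c"
  obtain p where p: "p \<le> k" and eq: "sup_convolution f g k = f p + g (k - p)"
    by (rule sup_convolution_attained)
  \<comment> \<open>Keep the power that is optimal for \<open>k\<close> and store the extra
    unit.\<close>
  have "g (k - p) \<le> g (Suc k - p)"
    using assms k p by (simp add: increasing_upto_def Suc_diff_le)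
  also have "f p + g (Suc k - p) \<le> sup_convolution f g (Suc k)"
    using p by (intro sup_convolution_ge) simp
  finally show "sup_convolution f g k \<le> sup_convolution f g (Suc k)" using eq by simp
qed

lemma concave_upto_sup_convolution:
  assumes f: "concave_upto c f" and g: "concave_upto c g"
  shows "concave_upto c (sup_convolution f g)"
  unfolding concave_upto_def
proof (intro allI impI)
  fix k assume k: "Suc (Suc k) \<le> c"
  obtain p where p: "p \<le> k" and ep: "sup_convolution f g k = f p + g (k - p)"
    by (rule sup_convolution_attained)
  obtain q where q: "q \<le> Suc (Suc k)"
    and eq: "sup_convolution f g (Suc (Suc k)) = f q + g (Suc (Suc k) - q)"
    by (rule sup_convolution_attained)
  note ge = sup_convolution_ge[of _ "Suc k" f g]
  \<comment> \<open>Two powers for energy \<open>k + 1\<close> built from the maximizers \<open>p\<close> and \<open>q\<close> by moving one unit,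
      either of what is stored or of what is spent.\<close>
  consider "q \<le> p" | "q = Suc p" | "Suc (Suc p) \<le> q" by linarith
  then show "sup_convolution f g k + sup_convolution f g (Suc (Suc k))
      \<le> 2 * sup_convolution f g (Suc k)"
  proof cases
    case 1
    have "g (k - p) + g (Suc (Suc k - q)) \<le> g (Suc (k - p)) + g (Suc k - q)"
      by (rule concave_uptoD[OF g]) (use 1 p k in auto)
    moreover have "Suc (Suc k - q) = Suc (Suc k) - q" "Suc (k - p) = Suc k - p"
      using 1 p by auto
    ultimately show ?thesis using ge[of p] ge[of q] 1 p ep eq by simp
  next
    case 2
    \<comment> \<open>The powers \<open>p\<close> and \<open>q\<close> at energy
      \<open>k + 1\<close> leave \<open>k + 2 - q\<close> and \<open>k - p\<close> in store, so the
      two sums agree exactly.\<close>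
    then show ?thesis using ge[of p] ge[of q] p ep eq by (simp add: Suc_diff_le)
  next
    case 3
    have "f p + f (Suc (q - 1)) \<le> f (Suc p) + f (q - 1)"
      by (rule concave_uptoD[OF f]) (use 3 k q in auto)
    moreover have "Suc (q - 1) = q" "Suc k - (q - 1) = Suc (Suc k) - q" using 3 q by auto
    ultimately show ?thesis using ge[of "Suc p"] ge[of "q - 1"] 3 q p ep eq by force
  qed
qed

section \<open>Closure under nonnegative combinations\<close>

lemma increasing_upto_sum:
  assumes "\<And>i. i \<in> I \<Longrightarrow> increasing_upto c (f i)" and "\<And>i. i \<in> I \<Longrightarrow> 0 \<le> w i"
  shows "increasing_upto c (\<lambda>y. \<Sum>i\<in>I. f i y * w i)"
  using assms by (auto simp: increasing_upto_def intro!: sum_mono mult_right_mono)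

lemma concave_upto_sum:
  fixes w :: "'i \<Rightarrow> real"
  assumes "\<And>i. i \<in> I \<Longrightarrow> concave_upto c (f i)" and "\<And>i. i \<in> I \<Longrightarrow> 0 \<le> w i"
  shows "concave_upto c (\<lambda>y. \<Sum>i\<in>I. f i y * w i)"
  unfolding concave_upto_def
proof (intro allI impI)
  fix k assume k: "Suc (Suc k) \<le> c"
  have "(\<Sum>i\<in>I. (f i k + f i (Suc (Suc k))) * w i) \<le> (\<Sum>i\<in>I. (2 * f i (Suc k)) * w i)"
    using assms k by (intro sum_mono mult_right_mono) (auto simp: concave_upto_def)
  then show "(\<Sum>i\<in>I. f i k * w i) + (\<Sum>i\<in>I. f i (Suc (Suc k)) * w i)
      \<le> 2 * (\<Sum>i\<in>I. f i (Suc k) * w i)"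
    by (simp add: algebra_simps sum.distrib sum_distrib_left)
qed

lemma increasing_upto_cmult: "0 \<le> a \<Longrightarrow> increasing_upto c f \<Longrightarrow> increasing_upto c (\<lambda>y. a * f y)"
  by (auto simp: increasing_upto_def intro: mult_left_mono)

lemma concave_upto_cmult:
  assumes "0 \<le> a" and "concave_upto c f"
  shows "concave_upto c (\<lambda>y. a * f y)"
  unfolding concave_upto_def
proof (intro allI impI)
  fix k assume "Suc (Suc k) \<le> c"
  then have "a * (f k + f (Suc (Suc k))) \<le> a * (2 * f (Suc k))"
    using assms by (intro mult_left_mono) (auto simp: concave_upto_def)
  then show "a * f k + a * f (Suc (Suc k)) \<le> 2 * (a * f (Suc k))"
    by (simp add: algebra_simps)
qed

section \<open>Concavity and increasing differences of the logarithmic reward\<close>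

lemma concave_upto_ln_affine:
  assumes "0 \<le> (x::real)"
  shows "concave_upto c (\<lambda>p. ln (1 + x * real p))"
  unfolding concave_upto_def
proof (intro allI impI)
  fix k
  have pos: "0 < 1 + x * real p" for p using assms by (simp add: add_pos_nonneg)
  \<comment> \<open>With \<open>a = 1 + x * (k + 1)\<close> this is
    \<open>(a - x) * (a + x) = a^2 - x^2\<close>, hence at most \<open>a^2\<close>.\<close>
  have "(1 + x * real k) * (1 + x * real (Suc (Suc k))) \<le> (1 + x * real (Suc k))\<^sup>2"
    using zero_le_power2[of x] by (simp add: power2_eq_square algebra_simps)
  then have "ln ((1 + x * real k) * (1 + x * real (Suc (Suc k)))) \<le> ln ((1 + x * real (Suc k))\<^sup>2)"
    by (intro ln_mono) (simp_all only: mult_pos_pos pos)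
  then show "ln (1 + x * real k) + ln (1 + x * real (Suc (Suc k))) \<le> 2 * ln (1 + x * real (Suc k))"
    using pos[of k] pos[of "Suc k"] pos[of "Suc (Suc k)"] by (simp add: ln_mult ln_realpow)
qed

lemma ln_affine_strict_increasing_differences:
  fixes x y p q :: real
  assumes "0 \<le> x" "x < y" "0 \<le> p" "p < q"
  shows "ln (1 + x * q) + ln (1 + y * p) < ln (1 + x * p) + ln (1 + y * q)"
proof -
  have pos: "0 < 1 + s * t" if "0 \<le> s" "0 \<le> t" for s t :: real
    using that by (simp add: add_pos_nonneg)
  \<comment> \<open>This product is exactly the difference of the two cross products compared
    next.\<close>
  have "0 < (y - x) * (q - p)" using assms by simp
  then have "(1 + x * q) * (1 + y * p) < (1 + x * p) * (1 + y * q)"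
    by (simp add: algebra_simps)
  then have "ln ((1 + x * q) * (1 + y * p)) < ln ((1 + x * p) * (1 + y * q))"
    using assms pos by (subst ln_less_cancel_iff) (simp_all add: mult_pos_pos)
  moreover have "0 < 1 + x * q" "0 < 1 + y * p" "0 < 1 + x * p" "0 < 1 + y * q"
    using assms by (auto intro!: pos)
  ultimately show ?thesis by (simp add: ln_mult)
qed

section \<open>The power allocation model\<close>

locale power_allocation =
  fixes M :: model
  assumes model: "power_allocation_model M"
begin

abbreviation "D \<equiv> disturbance_pmf M"
abbreviation "\<Omega> \<equiv> stream_space (measure_pmf D)"
abbreviation "expect \<equiv> measure_pmf.expectation D"

lemma discount: "0 < discount M" "discount M < 1" "0 \<le> discount M"
  using model by (auto simp: power_allocation_model_def)

lemma noise: "0 < noise M"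
  using model by (auto simp: power_allocation_model_def)

lemma fade_nonneg: "h \<in> fades M \<Longrightarrow> 0 \<le> h"
  using model by (auto simp: power_allocation_model_def)

lemma finite_disturbances: "finite (set_pmf D)"
  using model
  by (auto simp: power_allocation_model_def disturbance_pmf_def intro: finite_subset)

lemma finite_states: "finite (states M)"
  using model by (auto simp: power_allocation_model_def states_def)

lemma next_state_in_states: "d \<in> set_pmf D \<Longrightarrow> next_state M s P d \<in> states M"
  using model
  by (auto simp: power_allocation_model_def disturbance_pmf_def states_def next_state_def)

text \<open>Finite support makes the expectation a finite weighted sum, so shape properties and
  limits can be treated term by term.\<close>

lemma expect_sum: "expect f = (\<Sum>d\<in>set_pmf D. f d * pmf D d)"
  by (rule integral_measure_pmf_real) (auto simp: finite_disturbances)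

lemma expect_mono:
  assumes "\<And>d. d \<in> set_pmf D \<Longrightarrow> f d \<le> (g d :: real)"
  shows "expect f \<le> expect g"
  unfolding expect_sum using assms by (auto intro!: sum_mono mult_right_mono)

lemma expect_diff: "expect (\<lambda>d. f d - g d :: real) = expect f - expect g"
  by (intro Bochner_Integration.integral_diff integrable_measure_pmf_finite finite_disturbances)

lemma tendsto_expect:
  assumes "\<And>d. d \<in> set_pmf D \<Longrightarrow> (\<lambda>n. f n d) \<longlonglongrightarrow> (g d :: real)"
  shows "(\<lambda>n. expect (f n)) \<longlonglongrightarrow> expect g"
  unfolding expect_sum using assms by (intro tendsto_sum tendsto_mult tendsto_const)

lemma reward_nonneg: "s \<in> states M \<Longrightarrow> 0 \<le> reward M s P"
  using fade_nonneg noise by (auto simp: reward_def states_def)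

lemma reward_bounded:
  obtains B where "0 \<le> B" and "\<And>s P. s \<in> states M \<Longrightarrow> P \<in> actions s \<Longrightarrow> reward M s P \<le> B"
proof -
  have "finite ((\<lambda>(s, P). reward M s P) ` (SIGMA s:states M. actions s))"
    using finite_states by (intro finite_imageI finite_SigmaI) (auto simp: actions_def)
  then have "bdd_above ((\<lambda>(s, P). reward M s P) ` (SIGMA s:states M. actions s))"
    by (rule bdd_above_finite)
  then obtain B where "\<And>s P. s \<in> states M \<Longrightarrow> P \<in> actions s \<Longrightarrow> reward M s P \<le> B"
    by (auto simp: bdd_above_def)
  then show thesis by (intro that[of "max 0 B"]) (auto simp: max.coboundedI2)
qed

section \<open>The evaluation equation of a policy\<close>

lemma state_at_in_states:
  assumes "s \<in> states M" and "\<And>n. \<omega> !! n \<in> set_pmf D"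
  shows "state_at M \<mu> s \<omega> n \<in> states M"
  using assms by (induction n) (auto intro: next_state_in_states)

text \<open>The recursion of \<open>state_at\<close> peels off the last disturbance; first-step
  analysis needs the first one peeled off instead.\<close>

lemma state_at_Stream:
  "state_at M \<mu> s (d ## \<omega>) (Suc n) = state_at M \<mu> (next_state M s (\<mu> s) d) \<omega> n"
  by (induction n) auto

text \<open>A path is sure to stay in \<open>states M\<close> when its disturbances lie in the
  support, so the pathwise reward bounds become almost sure bounds through this fact.\<close>

lemma AE_disturbances: "AE \<omega> in \<Omega>. \<forall>n. \<omega> !! n \<in> set_pmf D"
proof -
  have "AE \<omega> in \<Omega>. stream_all (\<lambda>d. d \<in> set_pmf D) \<omega>"
    by (rule prob_space.AE_stream_all[OF prob_space_measure_pmf]) (auto simp: AE_measure_pmf)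
  then show ?thesis by (simp only: stream_all_def)
qed

text \<open>
  The fade component is real and \<open>\<mu>\<close> is arbitrary, so it matters that every subset of the state space
  is measurable; countability of the energy component makes this survive the pairing.
\<close>

lemma measurable_state_at: "(\<lambda>\<omega>. state_at M \<mu> s \<omega> n) \<in> measurable \<Omega> (count_space UNIV)"
proof (induction n)
  case (Suc n)
  have discrete: "(\<lambda>\<omega>. f (\<omega> !! n)) \<in> measurable \<Omega> (count_space UNIV)" for f :: "disturbance \<Rightarrow> 'b"
    by (rule measurable_compose[OF measurable_snth]) simp
  let ?f = "\<lambda>\<omega>. fst (state_at M \<mu> s \<omega> n) - \<mu> (state_at M \<mu> s \<omega> n)"
  have f: "?f \<in> measurable \<Omega> (count_space UNIV)"
    by (rule measurable_compose[OF Suc]) simp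
  have "(\<lambda>\<omega>. (\<lambda>k \<omega>. (min (k + fst (\<omega> !! n)) (capacity M), snd (\<omega> !! n))) (?f \<omega>) \<omega>)
      \<in> measurable \<Omega> (count_space UNIV)"
    by (rule measurable_compose_countable[OF _ f])
      (rule discrete[of "\<lambda>d. (min (k + fst d) (capacity M), snd d)" for k])
  then show ?case by (simp add: next_state_def)
qed simp

lemma measurable_total_reward [measurable]: "total_reward M \<mu> s \<in> borel_measurable \<Omega>"
proof -
  have [measurable]: "(\<lambda>\<omega>. reward M (state_at M \<mu> s \<omega> n) (\<mu> (state_at M \<mu> s \<omega> n))) \<in> borel_measurable \<Omega>"
    for n
    by (rule measurable_compose[OF measurable_state_at]) simp
  show ?thesis unfolding total_reward_def[abs_def] by measurable
qed

section \<open>Bounds and first-step analysis for a fixed policy\<close>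

context
  fixes \<mu> B
  assumes \<mu>: "\<mu> \<in> policies M"
    and B: "0 \<le> B" "\<And>s P. s \<in> states M \<Longrightarrow> P \<in> actions s \<Longrightarrow> reward M s P \<le> B"
begin

lemma discounted_reward_bounds:
  assumes "s \<in> states M" and "\<And>n. \<omega> !! n \<in> set_pmf D"
  shows "0 \<le> discount M ^ n * reward M (state_at M \<mu> s \<omega> n) (\<mu> (state_at M \<mu> s \<omega> n))"
    and "discount M ^ n * reward M (state_at M \<mu> s \<omega> n) (\<mu> (state_at M \<mu> s \<omega> n)) \<le> discount M ^ n * B"
  using state_at_in_states[OF assms] B \<mu> discount reward_nonneg
  by (auto simp: policies_def intro!: mult_left_mono)

lemma summable_discounted_reward:
  assumes "s \<in> states M" and "\<And>n. \<omega> !! n \<in> set_pmf D"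
  shows "summable (\<lambda>n. discount M ^ n * reward M (state_at M \<mu> s \<omega> n) (\<mu> (state_at M \<mu> s \<omega> n)))"
proof (rule summable_comparison_test')
  show "summable (\<lambda>n. discount M ^ n * B)"
    using discount by (intro summable_mult2 summable_geometric) auto
qed (use discounted_reward_bounds[OF assms] in auto)

lemma total_reward_bounds:
  assumes "s \<in> states M" and "\<And>n. \<omega> !! n \<in> set_pmf D"
  shows "0 \<le> total_reward M \<mu> s \<omega>" and "total_reward M \<mu> s \<omega> \<le> B / (1 - discount M)"
proof -
  show "0 \<le> total_reward M \<mu> s \<omega>" unfolding total_reward_def
    by (intro suminf_nonneg summable_discounted_reward discounted_reward_bounds assms)
  have "total_reward M \<mu> s \<omega> \<le> (\<Sum>n. discount M ^ n * B)" unfolding total_reward_def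
    using discount
    by (intro suminf_le summable_discounted_reward discounted_reward_bounds assms
        summable_mult2 summable_geometric) auto
  also have "\<dots> = B / (1 - discount M)"
    using discount suminf_geometric[of "discount M"]
    by (subst suminf_mult2[symmetric]) (auto intro: summable_geometric)
  finally show "total_reward M \<mu> s \<omega> \<le> B / (1 - discount M)" .
qed

lemma total_reward_Stream:
  assumes "s \<in> states M" and "d \<in> set_pmf D" and "\<And>n. \<omega> !! n \<in> set_pmf D"
  shows "total_reward M \<mu> s (d ## \<omega>)
    = reward M s (\<mu> s) + discount M * total_reward M \<mu> (next_state M s (\<mu> s) d) \<omega>"
proof -
  let ?s = "next_state M s (\<mu> s) d"
  let ?r = "\<lambda>s \<omega> n. reward M (state_at M \<mu> s \<omega> n) (\<mu> (state_at M \<mu> s \<omega> n))"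
  have "(d ## \<omega>) !! n \<in> set_pmf D" for n using assms by (cases n) auto
  then have sum: "summable (\<lambda>n. discount M ^ n * ?r s (d ## \<omega>) n)"
    by (intro summable_discounted_reward assms)
  have sum': "summable (\<lambda>n. discount M ^ n * ?r ?s \<omega> n)"
    by (intro summable_discounted_reward assms next_state_in_states)
  have "total_reward M \<mu> s (d ## \<omega>)
      = reward M s (\<mu> s) + (\<Sum>n. discount M ^ Suc n * ?r s (d ## \<omega>) (Suc n))"
    unfolding total_reward_def using suminf_split_head[OF sum] by simp
  also have "(\<Sum>n. discount M ^ Suc n * ?r s (d ## \<omega>) (Suc n))
      = (\<Sum>n. discount M * (discount M ^ n * ?r ?s \<omega> n))"
    by (simp only: state_at_Stream power_Suc mult.assoc)
  also have "\<dots> = discount M * total_reward M \<mu> ?s \<omega>"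
    unfolding total_reward_def by (rule suminf_mult[OF sum'])
  finally show ?thesis .
qed

lemma AE_total_reward_bounds:
  assumes "s \<in> states M"
  shows "AE \<omega> in \<Omega>. 0 \<le> total_reward M \<mu> s \<omega>"
    and "AE \<omega> in \<Omega>. total_reward M \<mu> s \<omega> \<le> B / (1 - discount M)"
  by (rule eventually_mono[OF AE_disturbances], rule total_reward_bounds[OF assms], blast)+

lemma integrable_total_reward:
  assumes "s \<in> states M"
  shows "integrable \<Omega> (total_reward M \<mu> s)"
proof -
  interpret S: prob_space \<Omega> by (rule prob_space.prob_space_stream_space[OF prob_space_measure_pmf])
  show ?thesis
  proof (rule S.integrable_const_bound)
    show "AE \<omega> in \<Omega>. norm (total_reward M \<mu> s \<omega>) \<le> B / (1 - discount M)"
      using AE_total_reward_bounds[OF assms] by eventually_elim auto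
  qed measurable
qed

lemma policy_value_nonneg:
  assumes "s \<in> states M"
  shows "0 \<le> policy_value M \<mu> s"
  unfolding policy_value_def
  by (rule integral_nonneg_AE) (rule AE_total_reward_bounds[OF assms])

text \<open>Splitting the stream measure at its first element is done for nonnegative integrals;
  this converts the value to that form.\<close>

lemma policy_value_nn_integral:
  assumes "s \<in> states M"
  shows "(\<integral>\<^sup>+\<omega>. ennreal (total_reward M \<mu> s \<omega>) \<partial>\<Omega>) = ennreal (policy_value M \<mu> s)"
  unfolding policy_value_def
  by (intro nn_integral_eq_integral integrable_total_reward AE_total_reward_bounds assms)

text \<open>Condition on the first disturbance \<open>d\<close>: the remaining stream again has law
  \<open>\<Omega>\<close>, and the total reward splits by
  \<open>total_reward_Stream\<close>.\<close>

lemma policy_value_equation: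
  assumes s: "s \<in> states M"
  shows "policy_value M \<mu> s = reward M s (\<mu> s)
    + discount M * expect (\<lambda>d. policy_value M \<mu> (next_state M s (\<mu> s) d))"
proof -
  interpret S: prob_space \<Omega> by (rule prob_space.prob_space_stream_space[OF prob_space_measure_pmf])
  let ?n = "next_state M s (\<mu> s)"
  let ?g = "\<lambda>d. reward M s (\<mu> s) + discount M * policy_value M \<mu> (?n d)"
  have r: "0 \<le> reward M s (\<mu> s)" by (rule reward_nonneg[OF s])
  have g: "0 \<le> ?g d" if "d \<in> set_pmf D" for d
    using that r discount policy_value_nonneg[OF next_state_in_states] by simp
  have int: "integrable D f" for f :: "disturbance \<Rightarrow> real"
    by (intro integrable_measure_pmf_finite finite_disturbances)
  have step: "(\<integral>\<^sup>+\<omega>. ennreal (total_reward M \<mu> s (d ## \<omega>)) \<partial>\<Omega>) = ennreal (?g d)"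
    if d: "d \<in> set_pmf D" for d
  proof -
    note nd = next_state_in_states[OF d, of s "\<mu> s"]
    have "AE \<omega> in \<Omega>. ennreal (total_reward M \<mu> s (d ## \<omega>))
        = ennreal (reward M s (\<mu> s) + discount M * total_reward M \<mu> (?n d) \<omega>)"
      using AE_disturbances by eventually_elim (simp add: total_reward_Stream[OF s d])
    then have "(\<integral>\<^sup>+\<omega>. ennreal (total_reward M \<mu> s (d ## \<omega>)) \<partial>\<Omega>)
        = (\<integral>\<^sup>+\<omega>. ennreal (reward M s (\<mu> s) + discount M * total_reward M \<mu> (?n d) \<omega>) \<partial>\<Omega>)"
      by (rule nn_integral_cong_AE)
    also have "\<dots> = ennreal (\<integral>\<omega>. reward M s (\<mu> s) + discount M * total_reward M \<mu> (?n d) \<omega> \<partial>\<Omega>)"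
    proof (rule nn_integral_eq_integral)
      show "AE \<omega> in \<Omega>. 0 \<le> reward M s (\<mu> s) + discount M * total_reward M \<mu> (?n d) \<omega>"
        using AE_total_reward_bounds(1)[OF nd] by eventually_elim (use r discount in simp)
    qed (intro Bochner_Integration.integrable_add integrable_mult_right integrable_total_reward nd
        S.integrable_const)
    also have "\<dots> = ennreal (?g d)"
      using integrable_total_reward[OF nd] by (simp add: policy_value_def S.prob_space)
    finally show ?thesis .
  qed
  have "ennreal (policy_value M \<mu> s)
      = (\<integral>\<^sup>+d. \<integral>\<^sup>+\<omega>. ennreal (total_reward M \<mu> s (d ## \<omega>)) \<partial>\<Omega> \<partial>D)"
    unfolding policy_value_nn_integral[OF s, symmetric]
    by (rule prob_space.nn_integral_stream_space[OF prob_space_measure_pmf]) measurable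
  also have "\<dots> = (\<integral>\<^sup>+d. ennreal (?g d) \<partial>D)"
    by (rule nn_integral_cong_AE) (auto simp: AE_measure_pmf_iff step)
  also have "\<dots> = ennreal (expect ?g)"
    by (rule nn_integral_eq_integral) (auto simp: AE_measure_pmf_iff int g)
  \<comment> \<open>Returning from \<open>ennreal\<close> to the reals requires both sides to be
    nonnegative.\<close>
  finally have "policy_value M \<mu> s = expect ?g"
    using policy_value_nonneg[OF s] g
    by (subst (asm) ennreal_inj) (auto intro!: integral_nonneg_AE simp: AE_measure_pmf_iff)
  also have "\<dots> = reward M s (\<mu> s) + discount M * expect (\<lambda>d. policy_value M \<mu> (?n d))"
    by (subst Bochner_Integration.integral_add) (auto simp: int)
  finally show ?thesis .
qed

end

section \<open>Value iteration\<close>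

text \<open>Already discounted, and a function of the energy left after transmission alone, because
  the disturbance is independent of the current fade.\<close>

definition continuation :: "(state \<Rightarrow> real) \<Rightarrow> nat \<Rightarrow> real" where
  "continuation v y = discount M * expect (\<lambda>d. v (min (y + fst d) (capacity M), snd d))"

lemma continuation_diff:
  "discount M * expect (\<lambda>d. v (next_state M s P d)) = continuation v (fst s - P)"
  by (simp add: continuation_def next_state_def)

lemma continuation_mono:
  assumes "\<And>s. s \<in> states M \<Longrightarrow> v s \<le> w s"
  shows "continuation v y \<le> continuation w y"
  \<comment> \<open>The artificial state \<open>(y, 0)\<close> with power 0 has as successor exactly
    the state at which \<open>continuation\<close> evaluates its argument.\<close>
  using next_state_in_states[of _ "(y, 0)" 0] discount assms
  unfolding continuation_def next_state_def
  by (intro mult_left_mono expect_mono) auto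

lemma continuation_cong:
  assumes "\<And>s. s \<in> states M \<Longrightarrow> v s = w s"
  shows "continuation v y = continuation w y"
  using continuation_mono[of v w y] continuation_mono[of w v y] assms by fastforce

lemma tendsto_continuation:
  assumes "\<And>s. s \<in> states M \<Longrightarrow> (\<lambda>n. v n s) \<longlonglongrightarrow> w s"
  shows "(\<lambda>n. continuation (v n) y) \<longlonglongrightarrow> continuation w y"
  using next_state_in_states[of _ "(y, 0)" 0] assms
  unfolding continuation_def next_state_def
  by (intro tendsto_mult tendsto_const tendsto_expect) auto

lemma continuation_const: "continuation (\<lambda>_. a) y = discount M * a"
  by (simp add: continuation_def)

lemma increasing_upto_continuation:
  assumes "\<And>h. h \<in> fades M \<Longrightarrow> increasing_upto (capacity M) (\<lambda>k. v (k, h))"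
  shows "increasing_upto (capacity M) (continuation v)"
  unfolding continuation_def expect_sum
  using discount next_state_in_states[of _ "(0, 0)" 0] assms
  by (intro increasing_upto_cmult increasing_upto_sum increasing_upto_recharge)
    (auto simp: next_state_def states_def)

lemma concave_upto_continuation:
  assumes "\<And>h. h \<in> fades M \<Longrightarrow> increasing_upto (capacity M) (\<lambda>k. v (k, h))"
    and "\<And>h. h \<in> fades M \<Longrightarrow> concave_upto (capacity M) (\<lambda>k. v (k, h))"
  shows "concave_upto (capacity M) (continuation v)"
  unfolding continuation_def expect_sum
  using discount next_state_in_states[of _ "(0, 0)" 0] assms
  by (intro concave_upto_cmult concave_upto_sum concave_upto_recharge)
    (auto simp: next_state_def states_def)

section \<open>The Bellman operator and its iterates\<close>

definition bellman :: "(state \<Rightarrow> real) \<Rightarrow> state \<Rightarrow> real" where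
  "bellman v s = sup_convolution (reward M s) (continuation v) (fst s)"

lemma bellman_ge:
  "P \<in> actions s \<Longrightarrow> reward M s P + continuation v (fst s - P) \<le> bellman v s"
  by (simp add: bellman_def actions_def sup_convolution_ge)

lemma bellman_attained:
  obtains P where "P \<in> actions s" and "bellman v s = reward M s P + continuation v (fst s - P)"
proof -
  obtain P where "P \<le> fst s" "bellman v s = reward M s P + continuation v (fst s - P)"
    unfolding bellman_def by (rule sup_convolution_attained)
  then show thesis using that by (simp add: actions_def)
qed

lemma bellman_mono:
  assumes "\<And>s. s \<in> states M \<Longrightarrow> v s \<le> w s"
  shows "bellman v s \<le> bellman w s"
proof -
  obtain P where P: "P \<in> actions s" and eq: "bellman v s = reward M s P + continuation v (fst s - P)"
    by (rule bellman_attained)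
  have "continuation v (fst s - P) \<le> continuation w (fst s - P)"
    by (rule continuation_mono[OF assms])
  with bellman_ge[OF P, of w] eq show ?thesis by linarith
qed

lemma concave_upto_reward:
  assumes "h \<in> fades M"
  shows "concave_upto c (reward M (k, h))"
  using concave_upto_ln_affine[of "h / noise M" c] fade_nonneg[OF assms] noise
  by (simp add: reward_def[abs_def])

lemma increasing_concave_bellman:
  assumes h: "h \<in> fades M"
    and "\<And>h. h \<in> fades M \<Longrightarrow> increasing_upto (capacity M) (\<lambda>k. v (k, h))"
    and "\<And>h. h \<in> fades M \<Longrightarrow> concave_upto (capacity M) (\<lambda>k. v (k, h))"
  shows "increasing_upto (capacity M) (\<lambda>k. bellman v (k, h))"
    and "concave_upto (capacity M) (\<lambda>k. bellman v (k, h))"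
proof -
  \<comment> \<open>The reward ignores the battery energy, so freezing it at 0 exhibits the Bellman
    step as one sup-convolution evaluated at \<open>k\<close>.\<close>
  have "reward M (k, h) = reward M (0, h)" for k by (simp add: reward_def[abs_def])
  then have eq: "(\<lambda>k. bellman v (k, h)) = sup_convolution (reward M (0, h)) (continuation v)"
    by (intro ext) (metis bellman_def fst_conv)
  show "increasing_upto (capacity M) (\<lambda>k. bellman v (k, h))"
    unfolding eq by (intro increasing_upto_sup_convolution increasing_upto_continuation assms)
  show "concave_upto (capacity M) (\<lambda>k. bellman v (k, h))"
    unfolding eq
    by (intro concave_upto_sup_convolution concave_upto_reward concave_upto_continuation assms)
qed

definition value_iterate :: "nat \<Rightarrow> state \<Rightarrow> real" where
  "value_iterate n = (bellman ^^ n) (\<lambda>_. 0)"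

lemma value_iterate_simps [simp]:
  "value_iterate 0 = (\<lambda>_. 0)"
  "value_iterate (Suc n) = bellman (value_iterate n)"
  by (simp_all add: value_iterate_def)

lemma value_iterate_increasing_concave:
  assumes "h \<in> fades M"
  shows "increasing_upto (capacity M) (\<lambda>k. value_iterate n (k, h))
       \<and> concave_upto (capacity M) (\<lambda>k. value_iterate n (k, h))"
  using assms
proof (induction n arbitrary: h)
  case 0
  then show ?case by (simp add: increasing_upto_def concave_upto_def)
next
  case (Suc n)
  then show ?case using increasing_concave_bellman[of h "value_iterate n"] by simp
qed

text \<open>Starting from zero, the first step goes up because power 0 earns a nonnegative reward;
  monotonicity of \<open>bellman\<close> propagates this.\<close>

lemma value_iterate_Suc_ge: "s \<in> states M \<Longrightarrow> value_iterate n s \<le> value_iterate (Suc n) s"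
proof (induction n arbitrary: s)
  case 0
  have "reward M s 0 + continuation (\<lambda>_. 0) (fst s - 0) \<le> bellman (\<lambda>_. 0) s"
    by (rule bellman_ge) (simp add: actions_def)
  then show ?case using reward_nonneg[OF 0, of 0] by (simp add: continuation_const)
next
  case (Suc n)
  have "bellman (value_iterate n) s \<le> bellman (value_iterate (Suc n)) s"
    by (rule bellman_mono) (rule Suc.IH)
  then show ?case by simp
qed

lemma value_iterate_bounded:
  assumes B: "0 \<le> B" "\<And>s P. s \<in> states M \<Longrightarrow> P \<in> actions s \<Longrightarrow> reward M s P \<le> B"
  shows "s \<in> states M \<Longrightarrow> value_iterate n s \<le> B / (1 - discount M)"
proof (induction n arbitrary: s)
  case 0
  then show ?case using B discount by simp
next
  case (Suc n)
  let ?C = "B / (1 - discount M)"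
  obtain P where P: "P \<in> actions s"
    and eq: "bellman (value_iterate n) s = reward M s P + continuation (value_iterate n) (fst s - P)"
    by (rule bellman_attained)
  have "continuation (value_iterate n) (fst s - P) \<le> continuation (\<lambda>_. ?C) (fst s - P)"
    by (rule continuation_mono) (rule Suc.IH)
  \<comment> \<open>The bound is chosen as the fixed point of
    \<open>x \<mapsto> B + discount M * x\<close>.\<close>
  moreover have "B + discount M * ?C = ?C" using discount by (simp add: field_simps)
  ultimately show ?case using B(2)[OF Suc.prems P] eq by (simp add: continuation_const)
qed

text \<open>Convergence is established on \<open>states M\<close>, where the iterates are increasing
  and bounded; facts about the limit are confined to those states.\<close>

definition limit_value :: "state \<Rightarrow> real" where
  "limit_value s = lim (\<lambda>n. value_iterate n s)"

lemma value_iterate_LIMSEQ: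
  assumes "s \<in> states M"
  shows "(\<lambda>n. value_iterate n s) \<longlonglongrightarrow> limit_value s"
    and "value_iterate n s \<le> limit_value s"
proof -
  obtain B where B: "0 \<le> B" "\<And>s P. s \<in> states M \<Longrightarrow> P \<in> actions s \<Longrightarrow> reward M s P \<le> B"
    by (rule reward_bounded) blast
  have inc: "incseq (\<lambda>n. value_iterate n s)"
    by (rule incseq_SucI) (rule value_iterate_Suc_ge[OF assms])
  then obtain L where "(\<lambda>n. value_iterate n s) \<longlonglongrightarrow> L"
    by (rule incseq_convergent[where B = "B / (1 - discount M)"])
      (use value_iterate_bounded[OF B assms] in auto)
  then show lim: "(\<lambda>n. value_iterate n s) \<longlonglongrightarrow> limit_value s"
    by (simp add: limit_value_def limI)
  show "value_iterate n s \<le> limit_value s"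
    by (rule incseq_le[OF inc lim])
qed

text \<open>One inequality is monotonicity of \<open>bellman\<close>. For the other, fix a power
  that is optimal for the limit and let \<open>n\<close> grow in that single term, which avoids
  interchanging limit and maximum.\<close>

lemma limit_value_bellman:
  assumes s: "s \<in> states M"
  shows "limit_value s = bellman limit_value s"
proof (rule antisym)
  show "limit_value s \<le> bellman limit_value s"
  proof (rule LIMSEQ_le_const2[OF value_iterate_LIMSEQ(1)[OF s]], intro exI allI impI)
    fix n
    have "value_iterate n s \<le> value_iterate (Suc n) s" by (rule value_iterate_Suc_ge[OF s])
    also have "\<dots> \<le> bellman limit_value s"
      unfolding value_iterate_simps by (rule bellman_mono) (rule value_iterate_LIMSEQ(2))
    finally show "value_iterate n s \<le> bellman limit_value s" .
  qed
next
  obtain P where P: "P \<in> actions s"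
    and eq: "bellman limit_value s = reward M s P + continuation limit_value (fst s - P)"
    by (rule bellman_attained)
  have "(\<lambda>n. reward M s P + continuation (value_iterate n) (fst s - P)) \<longlonglongrightarrow> bellman limit_value s"
    unfolding eq by (intro tendsto_add tendsto_const tendsto_continuation value_iterate_LIMSEQ)
  moreover have "reward M s P + continuation (value_iterate n) (fst s - P) \<le> limit_value s" for n
    using bellman_ge[OF P, of "value_iterate n"] value_iterate_LIMSEQ(2)[OF s, of "Suc n"] by simp
  ultimately show "bellman limit_value s \<le> limit_value s"
    by (intro LIMSEQ_le_const2) auto
qed

lemma limit_value_increasing_concave:
  assumes h: "h \<in> fades M"
  shows "increasing_upto (capacity M) (\<lambda>k. limit_value (k, h))"
    and "concave_upto (capacity M) (\<lambda>k. limit_value (k, h))"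
proof -
  note it = value_iterate_increasing_concave[OF h]
  have lim: "(\<lambda>n. value_iterate n (k, h)) \<longlonglongrightarrow> limit_value (k, h)" if "k \<le> capacity M" for k
    using that h by (intro value_iterate_LIMSEQ) (simp add: states_def)
  show "increasing_upto (capacity M) (\<lambda>k. limit_value (k, h))"
    unfolding increasing_upto_def
  proof (intro allI impI)
    fix k assume k: "Suc k \<le> capacity M"
    show "limit_value (k, h) \<le> limit_value (Suc k, h)"
      by (rule LIMSEQ_le[OF lim lim]) (use k it in \<open>auto simp: increasing_upto_def\<close>)
  qed
  show "concave_upto (capacity M) (\<lambda>k. limit_value (k, h))"
    unfolding concave_upto_def
  proof (intro allI impI)
    fix k assume k: "Suc (Suc k) \<le> capacity M"
    show "limit_value (k, h) + limit_value (Suc (Suc k), h) \<le> 2 * limit_value (Suc k, h)"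
      by (rule LIMSEQ_le[OF tendsto_add[OF lim lim] tendsto_mult[OF tendsto_const lim]])
        (use k it in \<open>auto simp: concave_upto_def\<close>)
  qed
qed

section \<open>The optimal reward\<close>

text \<open>At a state where \<open>f\<close> is maximal, the hypothesis gives \<open>Max f \<le> \<lambda> Max f\<close> with \<open>\<lambda> < 1\<close>.\<close>

lemma nonpos_if_le_continuation:
  assumes le: "\<And>s. s \<in> states M \<Longrightarrow> f s \<le> continuation f (fst s - \<mu> s)" and s: "s \<in> states M"
  shows "f s \<le> 0"
proof -
  let ?m = "Max (f ` states M)"
  have fin: "finite (f ` states M)" using finite_states by simp
  have ub: "f t \<le> ?m" if "t \<in> states M" for t using that fin by simp
  have "?m \<in> f ` states M" using fin s by (intro Max_in) auto
  then obtain t where t: "t \<in> states M" "?m = f t" by auto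
  note t(2)
  also have "f t \<le> continuation f (fst t - \<mu> t)" by (rule le[OF t(1)])
  also have "\<dots> \<le> continuation (\<lambda>_. ?m) (fst t - \<mu> t)" by (rule continuation_mono) (rule ub)
  finally have "(1 - discount M) * ?m \<le> 0" by (simp add: continuation_const algebra_simps)
  then have "?m \<le> 0" using discount by (simp add: mult_le_0_iff)
  then show ?thesis using ub[OF s] by simp
qed

lemma continuation_minus: "continuation (\<lambda>s. v s - w s) y = continuation v y - continuation w y"
  by (simp add: continuation_def expect_diff right_diff_distrib)

text \<open>The comparison principle is applied twice: a policy's value cannot exceed the limit,
  since its action is one candidate in the Bellman maximum; for a policy greedy with respect to the
  limit the reverse difference is nonpositive too. So the supremum is attained.\<close>

lemma optimal_reward_eq_limit_value:
  assumes s: "s \<in> states M"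
  shows "optimal_reward M s = limit_value s"
proof -
  obtain B where B: "0 \<le> B" "\<And>s P. s \<in> states M \<Longrightarrow> P \<in> actions s \<Longrightarrow> reward M s P \<le> B"
    by (rule reward_bounded) blast
  have eqn: "policy_value M \<nu> t = reward M t (\<nu> t) + continuation (policy_value M \<nu>) (fst t - \<nu> t)"
    if "\<nu> \<in> policies M" "t \<in> states M" for \<nu> t
    using policy_value_equation[OF that(1) B that(2)] by (simp add: continuation_diff)
  have le: "policy_value M \<nu> s \<le> limit_value s" if \<nu>: "\<nu> \<in> policies M" for \<nu>
  proof -
    have "policy_value M \<nu> s - limit_value s \<le> 0"
    proof (rule nonpos_if_le_continuation[where \<mu> = \<nu>, OF _ s])
      fix t assume t: "t \<in> states M"
      then have "\<nu> t \<in> actions t" using \<nu> by (simp add: policies_def)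
      from bellman_ge[OF this, of limit_value] eqn[OF \<nu> t] limit_value_bellman[OF t]
      show "policy_value M \<nu> t - limit_value t
          \<le> continuation (\<lambda>t. policy_value M \<nu> t - limit_value t) (fst t - \<nu> t)"
        by (simp add: continuation_minus)
    qed
    then show ?thesis by simp
  qed
  have "\<exists>P. P \<in> actions t \<and> bellman limit_value t = reward M t P + continuation limit_value (fst t - P)"
    for t by (rule bellman_attained[of t limit_value]) blast
  then obtain \<nu> where \<nu>: "\<And>t. \<nu> t \<in> actions t"
    and greedy: "\<And>t. bellman limit_value t = reward M t (\<nu> t) + continuation limit_value (fst t - \<nu> t)"
    by metis
  have pol: "\<nu> \<in> policies M" using \<nu> by (simp add: policies_def)
  have "limit_value s - policy_value M \<nu> s \<le> 0"
  proof (rule nonpos_if_le_continuation[where \<mu> = \<nu>, OF _ s])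
    fix t assume t: "t \<in> states M"
    from greedy[of t] eqn[OF pol t] limit_value_bellman[OF t]
    show "limit_value t - policy_value M \<nu> t
        \<le> continuation (\<lambda>t. limit_value t - policy_value M \<nu> t) (fst t - \<nu> t)"
      by (simp add: continuation_minus)
  qed
  with le[OF pol] have eq: "policy_value M \<nu> s = limit_value s" by simp
  show ?thesis unfolding optimal_reward_def
  proof (rule cSup_eq_maximum)
    show "limit_value s \<in> (\<lambda>\<mu>. policy_value M \<mu> s) ` policies M"
      using pol eq by (metis imageI)
  qed (use le in auto)
qed

lemma concave_upto_optimal_continuation:
  "concave_upto (capacity M) (continuation (optimal_reward M))"
proof -
  have "continuation (optimal_reward M) = continuation limit_value"
    by (intro ext continuation_cong optimal_reward_eq_limit_value)
  then show ?thesis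
    using concave_upto_continuation[of limit_value] limit_value_increasing_concave by simp
qed

section \<open>Comparison of maximizers\<close>

lemma action_value_eq:
  "action_value M s P = reward M s P + continuation (optimal_reward M) (fst s - P)"
  by (simp add: action_value_def continuation_diff)

lemma maximizers_iff:
  "P \<in> maximizers M s \<longleftrightarrow>
     P \<in> actions s \<and> (\<forall>Q\<in>actions s. action_value M s Q \<le> action_value M s P)"
  by (auto simp: maximizers_def is_arg_max_linorder)

lemma finite_maximizers: "finite (maximizers M s)"
  by (rule finite_subset[of _ "actions s"]) (auto simp: maximizers_iff actions_def)

text \<open>If \<open>q < p\<close>, adding the two optimality inequalities cancels the continuation
  terms, as the energy is the same, and contradicts strictly increasing differences. Strictness
  orders all maximizers, so ties do no harm here.\<close>

lemma maximizer_mono_fade: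
  assumes h: "g \<in> fades M" "g < h"
    and p: "p \<in> maximizers M (k, g)" and q: "q \<in> maximizers M (k, h)"
  shows "p \<le> q"
proof (rule ccontr)
  assume "\<not> p \<le> q"
  then have "ln (1 + g / noise M * p) + ln (1 + h / noise M * q)
      < ln (1 + g / noise M * q) + ln (1 + h / noise M * p)"
    using h noise fade_nonneg[OF h(1)]
    by (intro ln_affine_strict_increasing_differences)
      (auto simp: divide_strict_right_mono)
  moreover have "action_value M (k, g) q \<le> action_value M (k, g) p"
    and "action_value M (k, h) p \<le> action_value M (k, h) q"
    using p q by (auto simp: maximizers_iff actions_def)
  ultimately show False by (simp add: action_value_eq reward_def)
qed

text \<open>By concavity the advantage of \<open>p\<close> over \<open>q\<close> does not shrink
  from energy \<open>j\<close> to \<open>k\<close>. Optimality makes it nonnegative at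
  \<open>j\<close> and nonpositive at \<open>k\<close>, so it vanishes at both and the two powers
  tie.\<close>

lemma maximizers_exchange:
  assumes h: "h \<in> fades M" and jk: "j < k" "k \<le> capacity M"
    and p: "p \<in> maximizers M (j, h)" and q: "q \<in> maximizers M (k, h)" and "q < p"
  shows "q \<in> maximizers M (j, h)" and "p \<in> maximizers M (k, h)"
proof -
  let ?g = "continuation (optimal_reward M)"
  have pj: "p \<le> j" using p by (simp add: maximizers_iff actions_def)
  \<comment> \<open>Stored energies \<open>j - p\<close> and \<open>j - q\<close> are both shifted
    by the extra energy \<open>k - j\<close>.\<close>
  have "?g (j - p) + ?g ((j - q) + (k - j)) \<le> ?g ((j - p) + (k - j)) + ?g (j - q)"
    by (rule concave_upto_shift[OF concave_upto_optimal_continuation]) (use jk pj \<open>q < p\<close> in auto)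
  moreover have "(j - q) + (k - j) = k - q" "(j - p) + (k - j) = k - p"
    using jk pj \<open>q < p\<close> by auto
  ultimately have "action_value M (j, h) p - action_value M (j, h) q
      \<le> action_value M (k, h) p - action_value M (k, h) q"
    by (simp add: action_value_eq reward_def)
  moreover have "action_value M (j, h) q \<le> action_value M (j, h) p"
    and "action_value M (k, h) p \<le> action_value M (k, h) q"
    using p q pj jk \<open>q < p\<close> by (auto simp: maximizers_iff actions_def)
  ultimately have "action_value M (j, h) q = action_value M (j, h) p"
    and "action_value M (k, h) p = action_value M (k, h) q" by auto
  then show "q \<in> maximizers M (j, h)" and "p \<in> maximizers M (k, h)"
    using p q pj jk \<open>q < p\<close> by (auto simp: maximizers_iff actions_def)
qed

text \<open>After an inversion the exchange puts the smaller power among the maximizers at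
  \<open>j\<close>, below the least one, and the larger among those at \<open>k\<close>, above the
  greatest one; either convention is violated.\<close>

lemma optimal_rule_mono_energy:
  assumes \<mu>: "optimal_rule M \<mu>" "uniform_tie_breaking M \<mu>"
    and h: "h \<in> fades M" and jk: "j < k" "k \<le> capacity M"
  shows "\<mu> (j, h) \<le> \<mu> (k, h)"
proof (rule ccontr)
  assume "\<not> \<mu> (j, h) \<le> \<mu> (k, h)"
  then have less: "\<mu> (k, h) < \<mu> (j, h)" by simp
  have st: "(j, h) \<in> states M" "(k, h) \<in> states M" using h jk by (auto simp: states_def)
  then have "\<mu> (j, h) \<in> maximizers M (j, h)" "\<mu> (k, h) \<in> maximizers M (k, h)"
    using \<mu> by (auto simp: optimal_rule_def)
  note ex = maximizers_exchange[OF h jk this less]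
  from \<mu>(2) consider "\<mu> (j, h) = Min (maximizers M (j, h))" | "\<mu> (k, h) = Max (maximizers M (k, h))"
    using st unfolding uniform_tie_breaking_def by blast
  then show False
  proof cases
    case 1
    then show False using Min_le[OF finite_maximizers ex(1)] less by simp
  next
    case 2
    then show False using Max_ge[OF finite_maximizers ex(2)] less by simp
  qed
qed

end

theorem theorem1:
  fixes M :: model and \<mu> :: "state \<Rightarrow> nat"
  assumes "power_allocation_model M"
    and "optimal_rule M \<mu>"
  shows "(\<forall>\<xi>\<in>{0..capacity M}. \<forall>hp\<in>fades M. \<forall>hm\<in>fades M.
            hp > hm \<longrightarrow> \<mu> (\<xi>, hp) \<ge> \<mu> (\<xi>, hm)) \<and>
         (uniform_tie_breaking M \<mu> \<longrightarrow>
            (\<forall>h\<in>fades M. \<forall>xp\<in>{0..capacity M}. \<forall>xm\<in>{0..capacity M}.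
               xp > xm \<longrightarrow> \<mu> (xp, h) \<ge> \<mu> (xm, h)))"
proof -
  interpret power_allocation M by unfold_locales (rule assms(1))
  have "\<mu> s \<in> maximizers M s" if "s \<in> states M" for s
    using assms(2) that by (simp add: optimal_rule_def)
  then have "\<mu> (\<xi>, hm) \<le> \<mu> (\<xi>, hp)"
    if "\<xi> \<le> capacity M" "hp \<in> fades M" "hm \<in> fades M" "hm < hp" for \<xi> hp hm
    using that by (intro maximizer_mono_fade[of hm hp _ \<xi>]) (auto simp: states_def)
  then show ?thesis using optimal_rule_mono_energy[OF assms(2)] by auto
qed

end
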